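(* Let $\mathcal{H}$ be a real Hilbert space, let $M\colon\mathcal{H}\to\mathcal{H}$ be a bounded linear self-adjoint strongly positive operator, and let $\beta>0$. Suppose that $A\colon\mathcal{H}\to 2^{\mathcal{H}}$ is maximally monotone, that $C\colon\mathcal{H}\to\mathcal{H}$ is $\frac1\beta$-cocoercive with respect to $\|\cdot\|_M$, and that $\operatorname{zer}(A+C)=\{x\in\mathcal{H}: 0\in Ax+Cx\}$ is nonempty. Let $\epsilon\in\left(0,\min\left(1,\tfrac{4}{3+\beta}\right)\right)$ and let $(\zeta_n)_{n\in\mathbb{N}}$, $(\gamma_n)_{n\in\mathbb{N}}$, $(\lambda_n)_{n\in\mathbb{N}}$ be real sequences such that, for all $n\in\mathbb{N}$, $0\le\zeta_n\le 1-\epsilon$, $\epsilon\le\gamma_n\le\frac{4-3\epsilon}{\beta}$, and $\epsilon\le\lambda_n\le 2-\frac{\gamma_n\beta}{2}-\frac{\epsilon}{2}$. Let $(x_n)_{n\in\mathbb{N}}$, $(u_n)_{n\in\mathbb{N}}$, $(v_n)_{n\in\mathbb{N}}$, $(\ell_n^2)_{n\in\mathbb{N}}$ be generated by the forward--backward algorithm with deviations described in the context. Then: (i) the sequence $(\ell_n^2)_{n\in\mathbb{N}}$ is summable, and $(u_n)_{n\in\mathbb{N}}$ and $(v_n)_{n\in\mathbb{N}}$ converge to zero; (ii) for every $x^\star\in\operatorname{zer}(A+C)$, the sequence $(\|x_n-x^\star\|_M)_{n\in\mathbb{N}}$ converges; (iii) the sequence $(x_n)_{n\in\mathbb{N}}$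 converges weakly to a point in $\operatorname{zer}(A+C)$.
   Context: $\mathbb{N}=\{0,1,2,\dots\}$. A bounded self-adjoint linear operator $M$ on $\mathcal{H}$ is strongly positive if there is $c>0$ with $\langle x,Mx\rangle\ge c\|x\|^2$ for all $x$; then $M^{-1}$ exists and has the same properties. $\langle x,y\rangle_M=\langle x,My\rangle$, $\|x\|_M=\sqrt{\langle x,Mx\rangle}$, and similarly $\|x\|_{M^{-1}}=\sqrt{\langle x,M^{-1}x\rangle}$. $C$ is $\frac1\beta$-cocoercive with respect to $\|\cdot\|_M$ if $\langle Cx-Cy,x-y\rangle\ge\frac1\beta\|Cx-Cy\|_{M^{-1}}^2$ for all $x,y\in\mathcal{H}$. Algorithm (forward--backward splitting with deviations). Given $x_0\in\mathcal{H}$, set $u_0=v_0=0$. For $n=0,1,2,\dots$: $$y_n=x_n+u_n,$$ $$z_n=x_n+\frac{(1-\lambda_n)\gamma_n\beta}{2-\lambda_n\gamma_n\beta}u_n+v_n,$$ $$p_n=(M+\gamma_nA)^{-1}(Mz_n-\gamma_nCy_n),$$ $$x_{n+1}=x_n+\lambda_n(p_n-z_n),$$ and then $u_{n+1},v_{n+1}\in\mathcal{H}$ are chosen arbitrarily subject to $$\frac{\lambda_{n+1}\gamma_{n+1}\beta}{2-\lambda_{n+1}\gamma_{n+1}\beta}\|u_{n+1}\|_M^2+\frac{\lambda_{n+1}(2-\lambda_{n+1}\gamma_{n+1}\beta)}{4-2\lambda_{n+1}-\gamma_{n+1}\beta}\|v_{n+1}\|_M^2\le\zeta_n\ell_n^2,$$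 where $$\ell_n^2=\frac{\lambda_n(4-2\lambda_n-\gamma_n\beta)}{2}\left\|p_n-x_n+\frac{\lambda_n\gamma_n\beta}{2-\lambda_n\gamma_n\beta}u_n-\frac{2(1-\lambda_n)}{4-2\lambda_n-\gamma_n\beta}v_n\right\|_M^2.$$ (The parameter conditions guarantee $2-\lambda_n\gamma_n\beta>0$ and $4-2\lambda_n-\gamma_n\beta>0$ for all $n$.) *)

theory Defs
  imports "HOL-Analysis.Analysis"
begin

text \<open>A real Hilbert space is a type of sort \<open>{real_inner, complete_space}\<close>.
  A set-valued operator is a function of type \<open>'a \<Rightarrow> 'a set\<close>.\<close>

definition self_adjoint :: "('a::real_inner \<Rightarrow> 'a) \<Rightarrow> bool" where
  "self_adjoint M \<longleftrightarrow> (\<forall>x y. inner (M x) y = inner x (M y))"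

definition strongly_positive :: "('a::real_inner \<Rightarrow> 'a) \<Rightarrow> bool" where
  "strongly_positive M \<longleftrightarrow> (\<exists>c>0. \<forall>x. inner x (M x) \<ge> c * (norm x)\<^sup>2)"

definition norm_wrt :: "('a::real_inner \<Rightarrow> 'a) \<Rightarrow> 'a \<Rightarrow> real" where
  "norm_wrt M x = sqrt (inner x (M x))"

text \<open>\<open>\<kappa>\<close>-cocoercivity with respect to the norm induced by \<open>M\<close>. The dual norm uses \<open>inv M\<close>,
  which is a two-sided inverse: a bounded, self-adjoint, strongly positive operator on a Hilbert
  space is bijective.\<close>

definition cocoercive_wrt :: "real \<Rightarrow> ('a::real_inner \<Rightarrow> 'a) \<Rightarrow> ('a \<Rightarrow> 'a) \<Rightarrow> bool" where
  "cocoercive_wrt \<kappa> M C \<longleftrightarrow>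
     (\<forall>x y. inner (C x - C y) (x - y) \<ge> \<kappa> * (norm_wrt (inv M) (C x - C y))\<^sup>2)"

definition monotone_op :: "('a::real_inner \<Rightarrow> 'a set) \<Rightarrow> bool" where
  "monotone_op A \<longleftrightarrow> (\<forall>x y. \<forall>a\<in>A x. \<forall>b\<in>A y. inner (a - b) (x - y) \<ge> 0)"

definition maximally_monotone :: "('a::real_inner \<Rightarrow> 'a set) \<Rightarrow> bool" where
  "maximally_monotone A \<longleftrightarrow>
     monotone_op A \<and> (\<forall>B. monotone_op B \<and> (\<forall>x. A x \<subseteq> B x) \<longrightarrow> B = A)"

text \<open>The sum of a single-valued and a set-valued operator.\<close>

definition op_plus :: "('a::real_vector \<Rightarrow> 'a) \<Rightarrow> ('a \<Rightarrow> 'a set) \<Rightarrow> 'a \<Rightarrow> 'a set" where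
  "op_plus F A x = {F x + a | a. a \<in> A x}"

definition op_scale :: "real \<Rightarrow> ('a::real_vector \<Rightarrow> 'a set) \<Rightarrow> 'a \<Rightarrow> 'a set" where
  "op_scale r A x = {r *\<^sub>R a | a. a \<in> A x}"

definition op_inverse :: "('a \<Rightarrow> 'a set) \<Rightarrow> 'a \<Rightarrow> 'a set" where
  "op_inverse T w = {p. w \<in> T p}"

definition zer :: "('a::real_vector \<Rightarrow> 'a set) \<Rightarrow> 'a set" where
  "zer T = {x. 0 \<in> T x}"

definition weakly_converges_to :: "(nat \<Rightarrow> 'a::real_inner) \<Rightarrow> 'a \<Rightarrow> bool" where
  "weakly_converges_to x l \<longleftrightarrow> (\<forall>h. (\<lambda>n. inner (x n) h) \<longlonglongrightarrow> inner l h)"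

text \<open>The forward--backward iteration with deviations, as a relation between the parameters and
  the generated sequences; \<open>l2 n\<close> stands for the number written as \<open>\<ell>\<close> squared at index \<open>n\<close>.
  The deviations \<open>u\<close> and \<open>v\<close> are any sequences starting at \<open>0\<close> and satisfying the norm bound.
  If \<open>M\<close> is bounded, self-adjoint and strongly positive, \<open>A\<close> is maximally monotone and
  \<open>\<gamma> n > 0\<close>, the inverse of \<open>M + \<gamma> n A\<close> is single-valued with full domain, so
  membership in its value determines \<open>p n\<close>.\<close>

definition fb_with_deviations ::
  "('a::real_inner \<Rightarrow> 'a) \<Rightarrow> ('a \<Rightarrow> 'a set) \<Rightarrow> ('a \<Rightarrow> 'a) \<Rightarrow> real \<Rightarrow>
   (nat \<Rightarrow> real) \<Rightarrow> (nat \<Rightarrow> real) \<Rightarrow> (nat \<Rightarrow> real) \<Rightarrow>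
   (nat \<Rightarrow> 'a) \<Rightarrow> (nat \<Rightarrow> 'a) \<Rightarrow> (nat \<Rightarrow> 'a) \<Rightarrow> (nat \<Rightarrow> 'a) \<Rightarrow> (nat \<Rightarrow> 'a) \<Rightarrow> (nat \<Rightarrow> 'a) \<Rightarrow>
   (nat \<Rightarrow> real) \<Rightarrow> bool" where
  "fb_with_deviations M A C \<beta> \<zeta> \<gamma> lam x u v y z p l2 \<longleftrightarrow>
     u 0 = 0 \<and> v 0 = 0 \<and>
     (\<forall>n. y n = x n + u n) \<and>
     (\<forall>n. z n = x n + ((1 - lam n) * \<gamma> n * \<beta> / (2 - lam n * \<gamma> n * \<beta>)) *\<^sub>R u n + v n) \<and>
     (\<forall>n. p n \<in> op_inverse (op_plus M (op_scale (\<gamma> n) A)) (M (z n) - \<gamma> n *\<^sub>R C (y n))) \<and>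
     (\<forall>n. x (Suc n) = x n + lam n *\<^sub>R (p n - z n)) \<and>
     (\<forall>n. l2 n =
        lam n * (4 - 2 * lam n - \<gamma> n * \<beta>) / 2 *
        (norm_wrt M
          (p n - x n + (lam n * \<gamma> n * \<beta> / (2 - lam n * \<gamma> n * \<beta>)) *\<^sub>R u n
            - (2 * (1 - lam n) / (4 - 2 * lam n - \<gamma> n * \<beta>)) *\<^sub>R v n))\<^sup>2) \<and>
     (\<forall>n. lam (Suc n) * \<gamma> (Suc n) * \<beta> / (2 - lam (Suc n) * \<gamma> (Suc n) * \<beta>)
            * (norm_wrt M (u (Suc n)))\<^sup>2
        + lam (Suc n) * (2 - lam (Suc n) * \<gamma> (Suc n) * \<beta>)
            / (4 - 2 * lam (Suc n) - \<gamma> (Suc n) * \<beta>)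
            * (norm_wrt M (v (Suc n)))\<^sup>2
        \<le> \<zeta> n * l2 n)"

end

theory Submission
  imports Defs "HOL-Library.Diagonal_Subsequence"
begin

text \<open>
  Monotonicity of \<open>A\<close> and cocoercivity of \<open>C\<close> give, for every zero \<open>w\<close> of \<open>A + C\<close>, a decrease of
  \<open>\<parallel>x n - w\<parallel>\<^sub>M\<^sup>2\<close> by \<open>l2 n\<close> and by a multiple of
  \<open>\<parallel>M\<^sup>-\<^sup>1 (C (y n) - C w) + (\<beta> / 2) (p n - y n)\<parallel>\<^sub>M\<^sup>2\<close>, up to an error bounded by
  \<open>\<zeta> (n - 1) * l2 (n - 1)\<close>. As \<open>\<zeta> n \<le> 1 - \<epsilon>\<close>, the quantity
  \<open>\<parallel>x n - w\<parallel>\<^sub>M\<^sup>2 + \<zeta> (n - 1) * l2 (n - 1)\<close> is a Lyapunov function, both decrease terms are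
  summable, and \<open>u n\<close>, \<open>v n\<close>, \<open>p n - x n\<close> and \<open>p n - y n\<close> tend to zero. The second decrease term
  then shows that \<open>C (y n)\<close> converges strongly to \<open>C w\<close>. Hence weak cluster points of \<open>x\<close> are zeros
  of \<open>A + C\<close> by maximality of \<open>A\<close> alone, without maximality of the sum, and Opial's argument
  shows that there is only one of them.
\<close>

section \<open>Weak sequential compactness\<close>

text \<open>For \<open>M\<close> the identity this is Riesz representation on \<open>S\<close>, and
  with \<open>f = inner h\<close> it produces the orthogonal projection of \<open>h\<close>. For
  \<open>S = UNIV\<close> it yields surjectivity of a strongly positive \<open>M\<close>.\<close>

lemma linear_form_represented_on_subspace:
  fixes M :: "'a::{real_inner, complete_space} \<Rightarrow> 'a" and f :: "'a \<Rightarrow> real"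
  assumes lin: "bounded_linear M" and sa: "self_adjoint M" and sp: "strongly_positive M"
    and S: "subspace S" "closed S"
    and f_add: "\<And>a b. \<lbrakk>a \<in> S; b \<in> S\<rbrakk> \<Longrightarrow> f (a + b) = f a + f b"
    and f_scale: "\<And>r a. a \<in> S \<Longrightarrow> f (r *\<^sub>R a) = r * f a"
    and f_bound: "\<And>a. a \<in> S \<Longrightarrow> \<bar>f a\<bar> \<le> K * norm a"
  obtains w where "w \<in> S" "\<And>s. s \<in> S \<Longrightarrow> inner (M w) s = f s"
proof -
  interpret M: bounded_linear M by (fact lin)
  obtain c where c: "c > 0" "\<And>a. c * (norm a)\<^sup>2 \<le> inner a (M a)"
    using sp unfolding strongly_positive_def by blast
  \<comment> \<open>As in the Lax--Milgram theorem, \<open>w\<close> is the minimiser of \<open>J\<close> over \<open>S\<close>; by the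
    parallelogram law minimising sequences are Cauchy.\<close>
  define J where "J a = inner a (M a) - 2 * f a" for a
  have J_expand: "J (a + t *\<^sub>R s) = J a + 2 * t * (inner (M a) s - f s) + t\<^sup>2 * inner s (M s)"
    if "a \<in> S" "s \<in> S" for a s t
  proof -
    have "inner a (M s) = inner (M a) s" using sa unfolding self_adjoint_def by metis
    moreover have "f (a + t *\<^sub>R s) = f a + t * f s"
      using that S by (simp add: f_add f_scale subspace_scale)
    ultimately show ?thesis
      by (simp add: J_def M.add M.scaleR inner_add_left inner_add_right inner_commute
          algebra_simps power2_eq_square)
  qed
  \<comment> \<open>Coercivity and the bound on \<open>f\<close> leave a quadratic in
    \<open>norm a\<close>; completing its square bounds it below.\<close>
  have J_lower: "- K\<^sup>2 / c \<le> J a" if "a \<in> S" for a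
  proof -
    have "0 \<le> (c * norm a - K)\<^sup>2 / c" using c by simp
    also have "\<dots> = c * (norm a)\<^sup>2 - 2 * (K * norm a) + K\<^sup>2 / c"
      using c by (simp add: field_simps power2_eq_square)
    finally show ?thesis using c(2)[of a] f_bound[OF that] by (simp add: J_def)
  qed
  define m where "m = Inf (J ` S)"
  have bdd: "bdd_below (J ` S)" using J_lower by (rule bdd_belowI2)
  have S_ne: "J ` S \<noteq> {}" using subspace_0[OF S(1)] by auto
  have m_le: "m \<le> J a" if "a \<in> S" for a
    unfolding m_def using bdd that by (simp add: cInf_lower)
  have "\<exists>a\<in>S. J a < m + inverse (real (Suc n))" for n
    using cInf_lessD[OF S_ne, of "m + inverse (real (Suc n))"] by (auto simp: m_def)
  then obtain a where a: "\<And>n. a n \<in> S" "\<And>n. J (a n) < m + inverse (real (Suc n))"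
    by metis
  have close: "(c / 2) * (norm (a i - a j))\<^sup>2 \<le> 2 * inverse (real (Suc N))"
    if "N \<le> i" "N \<le> j" for i j N
  proof -
    define d where "d = a j - a i"
    have d: "d \<in> S" using a S by (simp add: d_def subspace_diff)
    have mid: "a i + (1/2) *\<^sub>R d \<in> S" using a S d by (simp add: subspace_add subspace_scale)
    have "J (a j) = J (a i + 1 *\<^sub>R d)" by (simp add: d_def)
    \<comment> \<open>Parallelogram identity: the midpoint lies in \<open>S\<close>, so its value is
      at least \<open>m\<close>, and two almost minimal values force \<open>d\<close> to be
      small.\<close>
    then have "J (a i) + J (a j) - 2 * J (a i + (1/2) *\<^sub>R d) = inner d (M d) / 2"
      unfolding J_expand[OF a(1) d] by (simp add: power2_eq_square)
    moreover have "inverse (real (Suc i)) \<le> inverse (real (Suc N))"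
      "inverse (real (Suc j)) \<le> inverse (real (Suc N))"
      using that by (auto intro!: le_imp_inverse_le)
    ultimately have "inner d (M d) / 2 \<le> 2 * inverse (real (Suc N))"
      using a(2)[of i] a(2)[of j] m_le[OF mid] by linarith
    then show ?thesis using c(2)[of d] by (simp add: d_def norm_minus_commute)
  qed
  have "Cauchy a"
  proof (rule metric_CauchyI)
    fix e :: real assume "e > 0"
    then have "0 < c * e\<^sup>2 / 4" using c by simp
    then obtain N where "inverse (real (Suc N)) < c * e\<^sup>2 / 4"
      using reals_Archimedean by blast
    then have "(norm (a i - a j))\<^sup>2 < e\<^sup>2" if "N \<le> i" "N \<le> j" for i j
    proof -
      have "(c / 2) * (norm (a i - a j))\<^sup>2 < (c / 2) * e\<^sup>2"
        using close[OF that] \<open>inverse (real (Suc N)) < c * e\<^sup>2 / 4\<close> by simp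
      then show ?thesis using c by simp
    qed
    then have "dist (a i) (a j) < e" if "N \<le> i" "N \<le> j" for i j
      using that \<open>e > 0\<close> by (metis dist_norm less_imp_le power_less_imp_less_base)
    then show "\<exists>N. \<forall>i\<ge>N. \<forall>j\<ge>N. dist (a i) (a j) < e" by blast
  qed
  then obtain w where w: "a \<longlonglongrightarrow> w" using Cauchy_convergent convergent_def by blast
  have "w \<in> S" using closed_sequentially[OF S(2) a(1) w] .
  moreover have "inner (M w) s = f s" if s: "s \<in> S" for s
  proof -
    define g where "g = inner (M w) s - f s"
    \<comment> \<open>Minimality of \<open>w\<close> along the line in direction \<open>s\<close>.
      Only the first variation is passed to the limit, in which \<open>f s\<close> is a
      constant.\<close>
    have quad: "0 \<le> 2 * t * g + t\<^sup>2 * inner s (M s)" for t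
    proof (rule LIMSEQ_le[OF _ _ exI, OF _ _ allI, OF _ _ impI])
      show "(\<lambda>n. - inverse (real (Suc n))) \<longlonglongrightarrow> 0"
        using LIMSEQ_inverse_real_of_nat tendsto_minus by fastforce
      show "(\<lambda>n. 2 * t * (inner (M (a n)) s - f s) + t\<^sup>2 * inner s (M s))
              \<longlonglongrightarrow> 2 * t * g + t\<^sup>2 * inner s (M s)"
        unfolding g_def by (intro tendsto_intros M.tendsto w)
      fix n
      have "m \<le> J (a n + t *\<^sub>R s)" using a s S by (simp add: m_le subspace_add subspace_scale)
      then show "- inverse (real (Suc n)) \<le> 2 * t * (inner (M (a n)) s - f s) + t\<^sup>2 * inner s (M s)"
        using a(2)[of n] J_expand[OF a(1) s] by fastforce
    qed
    have "g = 0"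
    proof (rule ccontr)
      assume "g \<noteq> 0"
      \<comment> \<open>The summand 1 keeps \<open>B\<close> positive even for \<open>s = 0\<close>.
        At \<open>t = - g / B\<close> the quadratic is negative unless \<open>g = 0\<close>.\<close>
      define B where "B = inner s (M s) + 1"
      have B: "B > 0" using c(2)[of s] c(1) zero_le_power2[of "norm s"]
        unfolding B_def by (smt (verit) mult_nonneg_nonneg)
      have "0 \<le> 2 * (- g / B) * g + (- g / B)\<^sup>2 * (B - 1)" using quad[of "- g / B"] by (simp add: B_def)
      also have "\<dots> = - g\<^sup>2 * (B + 1) / B\<^sup>2"
        using B by (simp add: field_simps power2_eq_square)
      also have "\<dots> < 0" using B \<open>g \<noteq> 0\<close> by (simp add: divide_neg_pos mult_neg_pos)
      finally show False by simp
    qed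
    then show ?thesis by (simp add: g_def)
  qed
  ultimately show thesis using that by blast
qed

text \<open>The countably many vectors \<open>x m\<close> themselves serve as test vectors for a
  diagonal subsequence, so the argument also covers non-separable spaces.\<close>

lemma bounded_imp_weakly_convergent_subsequence:
  fixes x :: "nat \<Rightarrow> 'a::{real_inner, complete_space}"
  assumes bnd: "\<And>n. norm (x n) \<le> R"
  obtains l r where "strict_mono r" "weakly_converges_to (x \<circ> r) l"
proof -
  have R: "0 \<le> R" using bnd[of 0] norm_ge_zero order_trans by blast
  interpret subseqs "\<lambda>m s. convergent (\<lambda>k. inner (x (s k)) (x m))"
  proof
    fix m and s :: "nat \<Rightarrow> nat"
    have "\<bar>inner (x (s k)) (x m)\<bar> \<le> R * norm (x m)" for k
      using Cauchy_Schwarz_ineq2[of "x (s k)" "x m"] bnd[of "s k"]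
      by (meson mult_right_mono norm_ge_zero order_trans)
    then have "bounded (range (\<lambda>k. inner (x (s k)) (x m)))"
      by (auto simp: bounded_iff)
    then obtain r l where "strict_mono r" "((\<lambda>k. inner (x (s k)) (x m)) \<circ> r) \<longlonglongrightarrow> l"
      using bounded_imp_convergent_subsequence by blast
    then show "\<exists>r. strict_mono r \<and> convergent (\<lambda>k. inner (x ((s \<circ> r) k)) (x m))"
      by (auto simp: convergent_def o_def)
  qed
  define r where "r = diagseq"
  have conv_x: "convergent (\<lambda>k. inner (x (r k)) (x m))" for m
  proof -
    \<comment> \<open>The diagonal sequence refines the extraction for \<open>x m\<close> only from
      index \<open>Suc m\<close> on; the initial segment is irrelevant for convergence.\<close>
    have "convergent (\<lambda>k. inner (x ((diagseq \<circ> (+) (Suc m)) k)) (x m))"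
    proof (rule diagseq_holds)
      fix r s :: "nat \<Rightarrow> nat" and n
      assume "strict_mono r" "convergent (\<lambda>k. inner (x (s k)) (x n))"
      then show "convergent (\<lambda>k. inner (x ((s \<circ> r) k)) (x n))"
        using convergent_subseq_convergent[of "\<lambda>k. inner (x (s k)) (x n)" r] by (simp add: o_def)
    qed
    then have "convergent (\<lambda>k. inner (x (r (k + Suc m))) (x m))"
      by (simp add: r_def o_def add.commute)
    then show ?thesis using convergent_ignore_initial_segment[of "\<lambda>k. inner (x (r k)) (x m)" "Suc m"] by simp
  qed
  \<comment> \<open>Every \<open>x m\<close> lies in \<open>S\<close>, so the orthogonal projection \<open>q\<close> of \<open>h\<close> onto \<open>S\<close>
    satisfies \<open>inner (x m) h = inner (x m) q\<close>, which gives convergence for all \<open>h\<close>.\<close>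
  define S where "S = {h. convergent (\<lambda>k. inner (x (r k)) h)}"
  have "subspace S"
    unfolding subspace_def S_def
    by (auto simp: inner_add_right intro: convergent_const convergent_add convergent_mult)
  have "closed S"
    unfolding closed_sequential_limits
  proof (intro allI impI, elim conjE)
    fix h l assume h: "\<forall>n. h n \<in> S" "h \<longlonglongrightarrow> l"
    have "Cauchy (\<lambda>k. inner (x (r k)) l)"
    proof (rule metric_CauchyI)
      fix e :: real assume e: "e > 0"
      \<comment> \<open>An e/3 argument; \<open>R + 1\<close> avoids dividing by zero when
        \<open>R = 0\<close>.\<close>
      have "0 < e / (3 * (R + 1))" using e R by simp
      then obtain j where "dist (h j) l < e / (3 * (R + 1))"
        using h(2) unfolding lim_sequentially by blast
      then have j: "norm (l - h j) * (R + 1) < e / 3"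
        using R by (simp add: dist_norm norm_minus_commute field_simps)
      have near: "\<bar>inner (x (r k)) l - inner (x (r k)) (h j)\<bar> < e / 3" for k
      proof -
        have "\<bar>inner (x (r k)) (l - h j)\<bar> \<le> (R + 1) * norm (l - h j)"
          using Cauchy_Schwarz_ineq2[of "x (r k)" "l - h j"] bnd[of "r k"]
          by (smt (verit, best) mult_right_mono norm_ge_zero)
        then show ?thesis using j by (simp add: inner_diff_right mult.commute)
      qed
      have "Cauchy (\<lambda>k. inner (x (r k)) (h j))"
        using h(1) by (simp add: S_def convergent_Cauchy)
      then obtain N where N: "\<forall>m\<ge>N. \<forall>n\<ge>N. dist (inner (x (r m)) (h j)) (inner (x (r n)) (h j)) < e / 3"
        using e unfolding Cauchy_def by (meson divide_pos_pos zero_less_numeral)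
      have "dist (inner (x (r m)) l) (inner (x (r n)) l) < e" if "m \<ge> N" "n \<ge> N" for m n
        using N[rule_format, OF that] near[of m] near[of n] unfolding dist_real_def by linarith
      then show "\<exists>N. \<forall>m\<ge>N. \<forall>n\<ge>N. dist (inner (x (r m)) l) (inner (x (r n)) l) < e" by blast
    qed
    then show "l \<in> S" by (simp add: S_def Cauchy_convergent)
  qed
  have id: "bounded_linear (\<lambda>a::'a. a)" "self_adjoint (\<lambda>a::'a. a)" "strongly_positive (\<lambda>a::'a. a)"
    by (auto simp: self_adjoint_def strongly_positive_def dot_square_norm bounded_linear_ident intro: exI[of _ 1])
  note represent = linear_form_represented_on_subspace[OF id \<open>subspace S\<close> \<open>closed S\<close>]
  \<comment> \<open>Outside \<open>S\<close> the value of \<open>lim\<close> is arbitrary; linearity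
    and the bound are claimed on \<open>S\<close> alone.\<close>
  define f where "f h = lim (\<lambda>k. inner (x (r k)) h)" for h
  have f: "(\<lambda>k. inner (x (r k)) h) \<longlonglongrightarrow> f h" if "h \<in> S" for h
    using that by (simp add: S_def f_def convergent_LIMSEQ_iff)
  obtain l where l: "l \<in> S" "\<And>s. s \<in> S \<Longrightarrow> inner l s = f s"
  proof (rule represent)
    fix a b assume ab: "a \<in> S" "b \<in> S"
    show "f (a + b) = f a + f b"
      using tendsto_add[OF f[OF ab(1)] f[OF ab(2)]] f[OF subspace_add[OF \<open>subspace S\<close> ab]]
      by (simp add: inner_add_right LIMSEQ_unique)
  next
    fix t a assume a: "a \<in> S"
    show "f (t *\<^sub>R a) = t * f a"
      using tendsto_mult_left[OF f[OF a], of t] f[OF subspace_scale[OF \<open>subspace S\<close> a, of t]]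
      by (simp add: LIMSEQ_unique)
  next
    fix a assume a: "a \<in> S"
    have "\<bar>inner (x (r k)) a\<bar> \<le> R * norm a" for k
      using Cauchy_Schwarz_ineq2[of "x (r k)" a] bnd[of "r k"]
      by (meson mult_right_mono norm_ge_zero order_trans)
    then show "\<bar>f a\<bar> \<le> R * norm a"
      using tendsto_rabs[OF f[OF a]] by (intro LIMSEQ_le_const2) auto
  qed blast
  have "(\<lambda>k. inner (x (r k)) h) \<longlonglongrightarrow> inner l h" for h
  proof -
    obtain q where q: "q \<in> S" "\<And>s. s \<in> S \<Longrightarrow> inner q s = inner h s"
      by (rule represent[of "inner h" "norm h"])
        (auto simp: inner_add_right Cauchy_Schwarz_ineq2)
    have "inner (x (r k)) h = inner (x (r k)) q" for k
      using q(2)[of "x (r k)"] conv_x by (simp add: S_def inner_commute)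
    moreover have "inner l h = f q"
      using q l by (metis inner_commute)
    ultimately show ?thesis using f[OF q(1)] by simp
  qed
  then show thesis
    using that[of r l] subseq_diagseq by (simp add: weakly_converges_to_def r_def o_def)
qed

text \<open>If some \<open>inner (x n) h\<close> stayed away from \<open>inner l h\<close> along a
  subsequence, weak compactness would give a further subsequence whose weak limit differs from
  \<open>l\<close>.\<close>

lemma weakly_converges_toI_subsequences:
  fixes x :: "nat \<Rightarrow> 'a::{real_inner, complete_space}"
  assumes bnd: "\<And>n. norm (x n) \<le> R"
    and unique: "\<And>r l'. strict_mono r \<Longrightarrow> weakly_converges_to (x \<circ> r) l' \<Longrightarrow> l' = l"
  shows "weakly_converges_to x l"
  unfolding weakly_converges_to_def
proof (rule allI, rule ccontr)
  fix h assume "\<not> (\<lambda>n. inner (x n) h) \<longlonglongrightarrow> inner l h"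
  then obtain e where e: "e > 0" "\<forall>N. \<exists>n\<ge>N. e \<le> \<bar>inner (x n) h - inner l h\<bar>"
    unfolding LIMSEQ_iff by (auto simp: not_less)
  then have "infinite {n. e \<le> \<bar>inner (x n) h - inner l h\<bar>}"
    by (auto simp: infinite_nat_iff_unbounded_le)
  from infinite_enumerate[OF this] obtain r :: "nat \<Rightarrow> nat"
    where r: "strict_mono r" "\<And>n. e \<le> \<bar>inner (x (r n)) h - inner l h\<bar>" by auto
  obtain s l' where s: "strict_mono s" "weakly_converges_to ((x \<circ> r) \<circ> s) l'"
    using bounded_imp_weakly_convergent_subsequence[of "x \<circ> r" R] bnd by (metis comp_apply)
  have "l' = l" using unique[of "r \<circ> s" l'] r(1) s by (simp add: o_assoc strict_mono_o)
  then have "(\<lambda>n. inner (x (r (s n))) h) \<longlonglongrightarrow> inner l h"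
    using s(2) by (simp add: weakly_converges_to_def)
  then obtain n where "\<bar>inner (x (r (s n))) h - inner l h\<bar> < e"
    using e(1) unfolding LIMSEQ_iff by fastforce
  then show False using r(2)[of "s n"] by simp
qed

text \<open>Products of two weakly convergent sequences may fail to converge; strong convergence of
  one factor is what lets the monotonicity inequality pass to the limit.\<close>

lemma tendsto_inner_weak_strong:
  assumes x: "weakly_converges_to x l" and bnd: "\<And>n. norm (x n) \<le> R" and g: "g \<longlonglongrightarrow> g'"
  shows "(\<lambda>n. inner (x n) (g n)) \<longlonglongrightarrow> inner l g'"
proof -
  have "(\<lambda>n. inner (x n) (g n - g')) \<longlonglongrightarrow> 0"
  proof (rule Lim_null_comparison)
    show "\<forall>\<^sub>F n in sequentially. norm (inner (x n) (g n - g')) \<le> R * norm (g n - g')"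
      using bnd by (intro always_eventually allI)
        (metis Cauchy_Schwarz_ineq2 mult_right_mono norm_ge_zero order_trans real_norm_def)
    show "(\<lambda>n. R * norm (g n - g')) \<longlonglongrightarrow> 0"
      using tendsto_mult_right_zero[OF tendsto_norm_zero[OF LIM_zero[OF g]]] by simp
  qed
  moreover have "(\<lambda>n. inner (x n) g') \<longlonglongrightarrow> inner l g'"
    using x by (simp add: weakly_converges_to_def)
  ultimately show ?thesis
    using tendsto_add by (fastforce simp: inner_diff_right)
qed

lemma weakly_converges_to_add_null:
  assumes "weakly_converges_to x l" and "w \<longlonglongrightarrow> 0"
  shows "weakly_converges_to (\<lambda>n. x n + w n) l"
  unfolding weakly_converges_to_def
proof
  fix h
  have "(\<lambda>n. inner (x n) h + inner (w n) h) \<longlonglongrightarrow> inner l h + inner 0 h"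
    using assms(1) unfolding weakly_converges_to_def
    by (intro tendsto_add tendsto_inner[OF assms(2) tendsto_const]) blast
  then show "(\<lambda>n. inner (x n + w n) h) \<longlonglongrightarrow> inner l h" by (simp add: inner_add_left)
qed

section \<open>Lyapunov decrease\<close>

text \<open>The error \<open>d (Suc n)\<close> is paid for by the decrease \<open>l n\<close> of the
  preceding step. Since \<open>\<zeta> n \<le> 1 - \<epsilon>\<close>, a share
  \<open>\<epsilon> * l n\<close> of that decrease remains and telescopes together with
  \<open>e n\<close>.\<close>

lemma lyapunov_summable_convergent:
  fixes a e l d \<zeta> :: "nat \<Rightarrow> real"
  assumes eps: "\<epsilon> > 0" and \<zeta>: "\<And>n. 0 \<le> \<zeta> n" "\<And>n. \<zeta> n \<le> 1 - \<epsilon>"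
    and nonneg: "\<And>n. 0 \<le> a n" "\<And>n. 0 \<le> e n" "\<And>n. 0 \<le> l n"
    and step: "\<And>n. a (Suc n) + e n \<le> a n - l n + d n"
    and d: "d 0 \<le> 0" "\<And>n. d (Suc n) \<le> \<zeta> n * l n"
  shows "summable l" "summable e" "convergent a"
proof -
  \<comment> \<open>There is no earlier decrease at index 0; the value 0 is admissible there because
    \<open>d 0 \<le> 0\<close>.\<close>
  define V where "V n = a n + (case n of 0 \<Rightarrow> 0 | Suc m \<Rightarrow> \<zeta> m * l m)" for n
  have V_step: "V (Suc n) + (\<epsilon> * l n + e n) \<le> V n" for n
  proof -
    have "(\<zeta> n + \<epsilon>) * l n \<le> 1 * l n"
      using \<zeta>(2)[of n] nonneg(3)[of n] by (intro mult_right_mono) auto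
    moreover have "a n + d n \<le> V n" using d by (cases n) (auto simp: V_def)
    ultimately show ?thesis using step[of n] by (simp add: V_def algebra_simps)
  qed
  have V_nonneg: "0 \<le> V n" for n using nonneg \<zeta> by (simp add: V_def split: nat.split)
  have partial: "(\<Sum>i<n. \<epsilon> * l i + e i) + V n \<le> V 0" for n
  proof (induction n)
    case (Suc n)
    then show ?case using V_step[of n] by simp
  qed simp
  have sum: "summable (\<lambda>n. \<epsilon> * l n + e n)"
  proof (rule summableI_nonneg_bounded)
    show "0 \<le> \<epsilon> * l n + e n" for n using eps nonneg by simp
    show "(\<Sum>i<n. \<epsilon> * l i + e i) \<le> V 0" for n
      using partial[of n] V_nonneg[of n] by linarith
  qed
  have "summable (\<lambda>n. \<epsilon> * l n)"
    by (rule summable_comparison_test'[OF sum]) (use eps nonneg in auto)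
  then show l: "summable l" using eps by (simp add: summable_cmult_iff)
  show "summable e"
    by (rule summable_comparison_test'[OF sum]) (use eps nonneg in auto)
  have "V (Suc n) \<le> V n" for n
    using V_step[of n] nonneg(2,3)[of n] mult_nonneg_nonneg[of \<epsilon> "l n"] eps by linarith
  then have "decseq V" by (simp add: decseq_Suc_iff)
  then obtain L where "V \<longlonglongrightarrow> L" using decseq_convergent V_nonneg by metis
  then have "(\<lambda>n. V (Suc n)) \<longlonglongrightarrow> L" by (rule LIMSEQ_Suc)
  moreover have "(\<lambda>n. \<zeta> n * l n) \<longlonglongrightarrow> 0"
  proof (rule Lim_null_comparison[OF _ summable_LIMSEQ_zero[OF l]])
    have "\<zeta> n * l n \<le> 1 * l n" for n
      using \<zeta>(2)[of n] eps nonneg by (intro mult_right_mono) auto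
    then show "\<forall>\<^sub>F n in sequentially. norm (\<zeta> n * l n) \<le> l n"
      using \<zeta> nonneg by simp
  qed
  ultimately have "(\<lambda>n. V (Suc n) - \<zeta> n * l n) \<longlonglongrightarrow> L - 0" by (rule tendsto_diff)
  then have "(\<lambda>n. a (Suc n)) \<longlonglongrightarrow> L" by (simp add: V_def)
  then have "a \<longlonglongrightarrow> L" by (simp add: filterlim_sequentially_Suc)
  then show "convergent a" by (rule convergentI)
qed

lemma tendsto_bounded_scaleR_zero:
  fixes w :: "nat \<Rightarrow> 'a::real_normed_vector"
  assumes "w \<longlonglongrightarrow> 0" and "\<And>n. \<bar>k n\<bar> \<le> K"
  shows "(\<lambda>n. k n *\<^sub>R w n) \<longlonglongrightarrow> 0"
proof (rule Lim_null_comparison)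
  show "\<forall>\<^sub>F n in sequentially. norm (k n *\<^sub>R w n) \<le> K * norm (w n)"
    using assms(2) by (simp add: mult_right_mono)
  show "(\<lambda>n. K * norm (w n)) \<longlonglongrightarrow> 0"
    using tendsto_mult_right_zero[OF tendsto_norm_zero[OF assms(1)]] by simp
qed

text \<open>Adding the single pair \<open>(x, a)\<close> to the graph of \<open>A\<close> keeps it
  monotone, so maximality says that the pair was already there.\<close>

lemma maximally_monotone_memI:
  assumes max: "maximally_monotone A"
    and mono: "\<And>q b. b \<in> A q \<Longrightarrow> 0 \<le> inner (a - b) (x - q)"
  shows "a \<in> A x"
proof -
  define B where "B q = (if q = x then insert a (A q) else A q)" for q
  have "monotone_op A" using max by (simp add: maximally_monotone_def)
  moreover have "0 \<le> inner (b - a) (q - x)" if "b \<in> A q" for q b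
    using mono[OF that] by (simp add: inner_diff_left inner_diff_right)
  ultimately have "monotone_op B"
    using mono by (auto simp: monotone_op_def B_def)
  moreover have "A q \<subseteq> B q" for q by (auto simp: B_def)
  ultimately have "B = A" using max unfolding maximally_monotone_def by blast
  then show ?thesis by (metis B_def insertI1)
qed

section \<open>Geometry of the norm induced by a strongly positive operator\<close>

locale spd_operator =
  fixes M :: "'a::{real_inner, complete_space} \<Rightarrow> 'a"
  assumes lin: "bounded_linear M" and sa: "self_adjoint M" and sp: "strongly_positive M"
begin

sublocale M: bounded_linear M by (fact lin)

lemma inner_M_swap: "inner a (M b) = inner b (M a)"
  using sa unfolding self_adjoint_def by (metis inner_commute)

lemma coercive: obtains c where "c > 0" "\<And>a. c * (norm a)\<^sup>2 \<le> inner a (M a)"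
  using sp unfolding strongly_positive_def by blast

lemma inner_nonneg: "0 \<le> inner a (M a)"
proof -
  obtain c where "c > 0" "c * (norm a)\<^sup>2 \<le> inner a (M a)" using coercive by metis
  then show ?thesis by (meson dual_order.trans less_imp_le mult_nonneg_nonneg zero_le_power2)
qed

lemma norm_wrt_power2: "(norm_wrt M a)\<^sup>2 = inner a (M a)"
  by (simp add: norm_wrt_def inner_nonneg)

text \<open>Representing the form \<open>inner d\<close> on the whole space shows that
  \<open>d\<close> is in the range of \<open>M\<close>, where the choice function
  \<open>inv M\<close> is a right inverse.\<close>

lemma M_inv: "M (inv M d) = d"
proof -
  obtain w where w: "\<And>s. inner (M w) s = inner d s"
    using linear_form_represented_on_subspace[OF lin sa sp subspace_UNIV closed_UNIV, of "inner d" "norm d"]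
    by (auto simp: inner_add_right Cauchy_Schwarz_ineq2)
  then have "M w = d" using vector_eq_rdot by blast
  then show ?thesis by (metis f_inv_into_f rangeI)
qed

lemma norm_wrt_inv_power2: "(norm_wrt (inv M) d)\<^sup>2 = inner (inv M d) (M (inv M d))"
  using inner_nonneg[of "inv M d"] by (simp add: norm_wrt_def M_inv inner_commute)

lemma null_sequenceI:
  assumes "(\<lambda>n. inner (a n) (M (a n))) \<longlonglongrightarrow> 0"
  shows "a \<longlonglongrightarrow> 0"
proof -
  obtain c where c: "c > 0" "\<And>a. c * (norm a)\<^sup>2 \<le> inner a (M a)" using coercive by metis
  have "(\<lambda>n. (norm (a n))\<^sup>2) \<longlonglongrightarrow> 0"
  proof (rule Lim_null_comparison)
    show "\<forall>\<^sub>F n in sequentially. norm ((norm (a n))\<^sup>2) \<le> inner (a n) (M (a n)) / c"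
      using c by (simp add: field_simps)
    show "(\<lambda>n. inner (a n) (M (a n)) / c) \<longlonglongrightarrow> 0"
      using tendsto_divide_zero[OF assms] by simp
  qed
  then have "(\<lambda>n. sqrt ((norm (a n))\<^sup>2)) \<longlonglongrightarrow> sqrt 0" by (rule tendsto_real_sqrt)
  then show ?thesis by (simp add: tendsto_norm_zero_iff)
qed

lemma null_sequenceI_scaled:
  assumes "b \<longlonglongrightarrow> 0" and "\<kappa> > 0" and "\<And>n. \<kappa> * inner (a n) (M (a n)) \<le> b n"
  shows "a \<longlonglongrightarrow> 0"
proof (rule null_sequenceI, rule Lim_null_comparison)
  show "\<forall>\<^sub>F n in sequentially. norm (inner (a n) (M (a n))) \<le> b n / \<kappa>"
    using assms(2,3) inner_nonneg by (simp add: field_simps)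
  show "(\<lambda>n. b n / \<kappa>) \<longlonglongrightarrow> 0" using tendsto_divide_zero[OF assms(1)] by simp
qed

lemma bounded_of_fejer:
  assumes "convergent (\<lambda>n. inner (x n - w) (M (x n - w)))"
  obtains R where "\<And>n. norm (x n) \<le> R"
proof -
  obtain c where c: "c > 0" "\<And>a. c * (norm a)\<^sup>2 \<le> inner a (M a)" using coercive by metis
  obtain K where K: "\<And>n. \<bar>inner (x n - w) (M (x n - w))\<bar> \<le> K"
    using convergent_imp_Bseq[OF assms] unfolding Bseq_def by auto
  have "norm (x n) \<le> norm w + (K / c + 1)" for n
  proof -
    have "c * (norm (x n - w))\<^sup>2 \<le> K" using c(2)[of "x n - w"] K[of n] by linarith
    then have sq: "(norm (x n - w))\<^sup>2 \<le> K / c" using c(1) by (simp add: field_simps)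
    \<comment> \<open>A bound on the squared norm becomes one on the norm through
      \<open>2 * r \<le> r\<^sup>2 + 1\<close>.\<close>
    have "0 \<le> (norm (x n - w) - 1)\<^sup>2" by simp
    then have "2 * norm (x n - w) \<le> (norm (x n - w))\<^sup>2 + 1"
      by (simp add: power2_diff)
    moreover have "0 \<le> K / c" using sq zero_le_power2 order_trans by blast
    ultimately have "norm (x n - w) \<le> K / c + 1" using sq by linarith
    then show ?thesis using norm_triangle_ineq[of w "x n - w"] by simp
  qed
  then show thesis using that by blast
qed

text \<open>In the iteration \<open>t\<close> is \<open>\<gamma> * \<beta>\<close>, \<open>w\<close>
  is \<open>p - x\<close> and \<open>e\<close> is \<open>z - x\<close>. Completing the square in
  \<open>w\<close> dictates the weights of \<open>u\<close> and \<open>v\<close> in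
  \<open>g\<close>. The coefficient of \<open>u\<close> in \<open>e\<close> is tuned so that the
  mixed term in \<open>u\<close> and \<open>v\<close> is absorbed too and only pure squares
  remain.\<close>

lemma deviation_identity:
  fixes lam t :: real
  assumes r: "r = 2 - lam * t" "r \<noteq> 0" and s: "s = 4 - 2 * lam - t" "s \<noteq> 0"
    and e: "e = ((1 - lam) * t / r) *\<^sub>R u + v"
    and g: "g = w + (lam * t / r) *\<^sub>R u - (2 * (1 - lam) / s) *\<^sub>R v"
  shows "- 2 * lam * inner (w - e) (M w) + lam * t / 2 * inner (w - u) (M (w - u))
           + lam\<^sup>2 * inner (w - e) (M (w - e))
         = - (lam * s / 2) * inner g (M g) + lam * t / r * inner u (M u) + lam * r / s * inner v (M v)"
proof -
  define a k h where "a = (1 - lam) * t / r" and "k = lam * t / r" and "h = 2 * (1 - lam) / s"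
  have ww: "- 2 * lam + lam * t / 2 + lam\<^sup>2 = - (lam * s / 2)"
    by (simp add: s(1) field_simps power2_eq_square)
  \<comment> \<open>These relations free of denominators reduce each of the six coefficient
    comparisons to a polynomial identity, after multiplication by a power of \<open>r\<close> or
    \<open>s\<close> where needed.\<close>
  have ra: "r * a = (1 - lam) * t" and rk: "r * k = lam * t" and sh: "s * h = 2 * (1 - lam)"
    using r(2) s(2) by (auto simp: a_def k_def h_def)
  have wv: "2 * lam - 2 * lam\<^sup>2 = lam * s * h"
    unfolding mult.assoc sh by (simp add: power2_eq_square algebra_simps)
  have "r * (2 * lam * a - lam * t - 2 * lam\<^sup>2 * a) = r * (- (lam * s * k))"
    using ra rk unfolding r(1) s(1) by algebra
  then have wu: "2 * lam * a - lam * t - 2 * lam\<^sup>2 * a = - (lam * s * k)"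
    using r(2) mult_left_cancel by blast
  have "r * (2 * lam\<^sup>2 * a) = r * (lam * s * k * h)"
    using ra rk sh by algebra
  then have uv: "2 * lam\<^sup>2 * a = lam * s * k * h" using r(2) by simp
  have "s * lam\<^sup>2 = s * (- (lam * s / 2 * h\<^sup>2) + lam * r / s)"
  proof -
    have "s * (- (lam * s / 2 * h\<^sup>2) + lam * r / s) = - (lam / 2 * (s * h)\<^sup>2) + lam * r"
      using s(2) by (simp add: field_simps power2_eq_square)
    also have "\<dots> = s * lam\<^sup>2"
      unfolding sh by (simp add: r(1) s(1) field_simps power2_eq_square)
    finally show ?thesis by (rule sym)
  qed
  then have vv: "lam\<^sup>2 = - (lam * s / 2 * h\<^sup>2) + lam * r / s" 
    using s(2) mult_left_cancel by blast
  have "r\<^sup>2 * (lam * t / 2 + lam\<^sup>2 * a\<^sup>2) = r\<^sup>2 * (- (lam * s / 2 * k\<^sup>2) + k)"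
  proof -
    have "r\<^sup>2 * (lam * t / 2 + lam\<^sup>2 * a\<^sup>2) = r\<^sup>2 * (lam * t / 2) + lam\<^sup>2 * (r * a)\<^sup>2"
      by (simp add: algebra_simps power_mult_distrib)
    also have "\<dots> = - (lam * s / 2 * (r * k)\<^sup>2) + r * (r * k)"
      unfolding ra rk by (simp add: r(1) s(1) field_simps power2_eq_square)
    also have "\<dots> = r\<^sup>2 * (- (lam * s / 2 * k\<^sup>2) + k)"
      by (simp add: algebra_simps power2_eq_square)
    finally show ?thesis .
  qed
  then have uu: "lam * t / 2 + lam\<^sup>2 * a\<^sup>2 = - (lam * s / 2 * k\<^sup>2) + k" using r(2) by simp
  \<comment> \<open>By symmetry of \<open>M\<close> six numbers determine all the inner products, so
    both sides become polynomials in them.\<close>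
  define WW UU VV WU WV UV where "WW = inner w (M w)" and "UU = inner u (M u)"
    and "VV = inner v (M v)" and "WU = inner w (M u)" and "WV = inner w (M v)" and "UV = inner u (M v)"
  have swap: "inner u (M w) = WU" "inner v (M w) = WV" "inner v (M u) = UV"
    unfolding WU_def WV_def UV_def by (rule inner_M_swap)+
  note inners = M.add M.diff M.scaleR inner_add_left inner_add_right inner_diff_left
    inner_diff_right swap WW_def[symmetric] UU_def[symmetric] VV_def[symmetric]
    WU_def[symmetric] WV_def[symmetric] UV_def[symmetric]
  have "- 2 * lam * inner (w - e) (M w) + lam * t / 2 * inner (w - u) (M (w - u))
           + lam\<^sup>2 * inner (w - e) (M (w - e))
      = (- 2 * lam + lam * t / 2 + lam\<^sup>2) * WW + (lam * t / 2 + lam\<^sup>2 * a\<^sup>2) * UU + lam\<^sup>2 * VV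
        + (2 * lam * a - lam * t - 2 * lam\<^sup>2 * a) * WU + (2 * lam - 2 * lam\<^sup>2) * WV
        + (2 * lam\<^sup>2 * a) * UV"
    unfolding e a_def[symmetric] by (simp add: inners algebra_simps power2_eq_square)
  also have "\<dots> = - (lam * s / 2) * WW + (- (lam * s / 2 * k\<^sup>2) + k) * UU
        + (- (lam * s / 2 * h\<^sup>2) + lam * r / s) * VV
        - (lam * s * k) * WU + (lam * s * h) * WV + (lam * s * k * h) * UV"
    using ww uu vv wu wv uv by simp
  also have "\<dots> = - (lam * s / 2) * inner g (M g) + k * UU + lam * r / s * VV"
    unfolding g k_def[symmetric] h_def[symmetric]
    by (simp add: inners algebra_simps power2_eq_square)
  finally show ?thesis by (simp add: k_def UU_def VV_def)
qed

text \<open>Usually the term in \<open>f\<close> is dropped by Young's inequality. It is kept here since its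
  summability is what makes \<open>C (y n)\<close> converge strongly.\<close>

lemma forward_backward_step:
  fixes lam \<gamma> \<beta> :: real
  assumes pos: "lam > 0" "\<gamma> > 0" "\<beta> > 0"
    and r: "r = 2 - lam * \<gamma> * \<beta>" "r \<noteq> 0" and s: "s = 4 - 2 * lam - \<gamma> * \<beta>" "s \<noteq> 0"
    and y: "y = x + u" and z: "z = x + ((1 - lam) * \<gamma> * \<beta> / r) *\<^sub>R u + v"
    and mono: "0 \<le> inner (M z - M p - \<gamma> *\<^sub>R d) (p - w)"
    and coco: "1 / \<beta> * (norm_wrt (inv M) d)\<^sup>2 \<le> inner d (y - w)"
    and g: "g = p - x + (lam * \<gamma> * \<beta> / r) *\<^sub>R u - (2 * (1 - lam) / s) *\<^sub>R v"
    and f: "f = inv M d + (\<beta> / 2) *\<^sub>R (p - y)"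
    and x': "x' = x + lam *\<^sub>R (p - z)"
  shows "inner (x' - w) (M (x' - w)) + 2 * lam * \<gamma> / \<beta> * inner f (M f)
    \<le> inner (x - w) (M (x - w)) - lam * s / 2 * inner g (M g)
      + (lam * \<gamma> * \<beta> / r * inner u (M u) + lam * r / s * inner v (M v))"
proof -
  \<comment> \<open>Writing \<open>d = M e\<close> turns the dual norm of \<open>d\<close> into the
    \<open>M\<close>-norm of \<open>e\<close>, so that all terms live in one inner product.\<close>
  define e where "e = inv M d"
  have d: "d = M e" by (simp add: e_def M_inv)
  have "\<gamma> * (1 / \<beta> * inner e (M e)) \<le> \<gamma> * inner d (y - w)"
    using coco pos by (intro mult_left_mono) (auto simp: norm_wrt_inv_power2 e_def)
  moreover have "inner (M z - M p - \<gamma> *\<^sub>R d) (p - w)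
      = inner (z - p) (M (p - w)) - \<gamma> * inner d (y - w) - \<gamma> * inner e (M (p - y))"
    unfolding d by (simp add: inner_diff_left inner_diff_right M.diff inner_M_swap inner_commute algebra_simps)
  \<comment> \<open>The cocoercivity term and the cross term in \<open>p - y\<close> are completed
    to the square of \<open>f\<close>; the leftover square of \<open>p - y\<close> goes into
    \<open>deviation_identity\<close>.\<close>
  moreover have "\<gamma> / \<beta> * inner f (M f) - \<gamma> * \<beta> / 4 * inner (p - y) (M (p - y))
      = \<gamma> * (1 / \<beta> * inner e (M e)) + \<gamma> * inner e (M (p - y))"
  proof -
    define q where "q = p - y"
    have "inner f (M f) = inner e (M e) + \<beta> * inner e (M q) + \<beta>\<^sup>2 / 4 * inner q (M q)"
      unfolding f e_def[symmetric] q_def[symmetric]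
      by (simp add: M.add M.scaleR inner_add_left inner_add_right inner_M_swap[of q e] power2_eq_square
          field_simps)
    then show ?thesis using pos unfolding q_def[symmetric]
      by (simp add: field_simps power2_eq_square)
  qed
  ultimately have key: "\<gamma> / \<beta> * inner f (M f) - \<gamma> * \<beta> / 4 * inner (p - y) (M (p - y))
      \<le> inner (z - p) (M (p - w))"
    using mono by linarith
  define W E where "W = p - x" and "E = ((1 - lam) * (\<gamma> * \<beta>) / r) *\<^sub>R u + v"
  have pz: "p - z = W - E" and py: "p - y = W - u"
    by (auto simp: W_def E_def z y mult.assoc)
  \<comment> \<open>Split \<open>x - w\<close> as \<open>(p - w) - (p - x)\<close>: the first part
    is bounded by \<open>key\<close>, the second is \<open>W\<close>.\<close>
  have "inner (p - z) (M (x - w)) = - inner (W - E) (M W) - inner (z - p) (M (p - w))"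
    unfolding pz[symmetric] unfolding W_def
    by (simp add: inner_diff_left inner_diff_right M.diff)
  from arg_cong[OF this, of "(*) (2 * lam)"]
  have "2 * lam * inner (p - z) (M (x - w))
      = - 2 * lam * inner (W - E) (M W) - 2 * lam * inner (z - p) (M (p - w))"
    by (simp only: right_diff_distrib)
  moreover have "inner (x' - w) (M (x' - w))
      = inner (x - w) (M (x - w)) + 2 * lam * inner (p - z) (M (x - w))
        + lam\<^sup>2 * inner (p - z) (M (p - z))"
  proof -
    define a b where "a = x - w" and "b = p - z"
    have "x' - w = a + lam *\<^sub>R b" by (simp add: x' a_def b_def)
    then show ?thesis unfolding a_def[symmetric] b_def[symmetric]
      by (simp add: M.add M.scaleR inner_add_left inner_add_right inner_M_swap[of a b] power2_eq_square
          algebra_simps)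
  qed
  moreover have "2 * lam * (\<gamma> / \<beta> * inner f (M f) - \<gamma> * \<beta> / 4 * inner (p - y) (M (p - y)))
      \<le> 2 * lam * inner (z - p) (M (p - w))"
    using key pos by (intro mult_left_mono) auto
  then have "2 * lam * \<gamma> / \<beta> * inner f (M f) - lam * \<gamma> * \<beta> / 2 * inner (p - y) (M (p - y))
      \<le> 2 * lam * inner (z - p) (M (p - w))"
    by (simp add: algebra_simps)
  moreover have "- 2 * lam * inner (W - E) (M W) + lam * (\<gamma> * \<beta>) / 2 * inner (W - u) (M (W - u))
           + lam\<^sup>2 * inner (W - E) (M (W - E))
         = - (lam * s / 2) * inner g (M g) + lam * (\<gamma> * \<beta>) / r * inner u (M u) + lam * r / s * inner v (M v)"
    by (rule deviation_identity)
      (use r s in \<open>auto simp: E_def W_def g mult.assoc\<close>)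
  ultimately show ?thesis unfolding pz py mult.assoc[symmetric] by linarith
qed

text \<open>The inclusions for \<open>A\<close> and \<open>C\<close> are closed separately: strong
  convergence of \<open>a\<close> gives \<open>- c \<in> A l\<close>, and cocoercivity identifies
  \<open>c\<close> as \<open>C l\<close>.\<close>

lemma weak_limit_in_zer:
  assumes max: "maximally_monotone A" and "\<beta> > 0" and coco: "cocoercive_wrt (1 / \<beta>) M C"
    and p: "weakly_converges_to p l" "\<And>n. norm (p n) \<le> R"
    and y: "(\<lambda>n. y n - p n) \<longlonglongrightarrow> 0"
    and a: "\<And>n. a n \<in> A (p n)" "a \<longlonglongrightarrow> - c" and C: "(\<lambda>n. C (y n)) \<longlonglongrightarrow> c"
  shows "l \<in> zer (op_plus C A)"
proof -
  have gap: "(\<lambda>n. inner (p n - q) (g n)) \<longlonglongrightarrow> inner (l - q) g'" if "g \<longlonglongrightarrow> g'" for q g g'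
    unfolding inner_diff_left
    by (intro tendsto_diff tendsto_inner_weak_strong[OF p that] tendsto_inner[OF tendsto_const that])
  have mono: "monotone_op A" using max by (simp add: maximally_monotone_def)
  have "- c \<in> A l"
  proof (rule maximally_monotone_memI[OF max])
    fix q b assume b: "b \<in> A q"
    have "(\<lambda>n. inner (p n - q) (a n - b)) \<longlonglongrightarrow> inner (l - q) (- c - b)"
      by (intro gap tendsto_diff a(2) tendsto_const)
    moreover have "0 \<le> inner (p n - q) (a n - b)" for n
      using mono a(1)[of n] b unfolding monotone_op_def by (metis inner_commute)
    ultimately have "0 \<le> inner (l - q) (- c - b)" by (intro LIMSEQ_le_const) auto
    then show "0 \<le> inner (- c - b) (l - q)" by (simp add: inner_commute)
  qed
  \<comment> \<open>Cocoercivity is tested at \<open>y n\<close> and the weak limit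
    \<open>l\<close>. Its right-hand side tends to 0, as \<open>y n - l\<close> is weakly null and
    \<open>C (y n) - C l\<close> converges strongly.\<close>
  moreover have "C l = c"
  proof -
    define D where "D n = inv M (C (y n) - C l)" for n
    have C_diff: "(\<lambda>n. C (y n) - C l) \<longlonglongrightarrow> c - C l" by (intro tendsto_diff C tendsto_const)
    have "(\<lambda>n. inner (y n - p n) (C (y n) - C l) + inner (p n - l) (C (y n) - C l))
        \<longlonglongrightarrow> inner 0 (c - C l) + inner (l - l) (c - C l)"
      by (intro tendsto_add tendsto_inner[OF y C_diff] gap C_diff)
    then have "(\<lambda>n. inner (C (y n) - C l) (y n - l)) \<longlonglongrightarrow> 0"
      by (simp add: inner_add_left[symmetric] inner_commute)
    moreover have "1 / \<beta> * inner (D n) (M (D n)) \<le> inner (C (y n) - C l) (y n - l)" for n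
      using coco unfolding cocoercive_wrt_def norm_wrt_inv_power2 D_def by blast
    ultimately have "D \<longlonglongrightarrow> 0"
      using \<open>\<beta> > 0\<close> by (intro null_sequenceI_scaled[of _ "1 / \<beta>"]) auto
    then have "(\<lambda>n. M (D n)) \<longlonglongrightarrow> M 0" by (rule M.tendsto)
    then have "(\<lambda>n. C (y n) - C l) \<longlonglongrightarrow> 0" by (simp add: D_def M_inv M.zero)
    then show ?thesis using C_diff LIMSEQ_unique by fastforce
  qed
  ultimately show ?thesis unfolding zer_def op_plus_def by force
qed

text \<open>The difference of the two squared distances is affine in \<open>x n\<close>, so
  \<open>inner (x n) (M (b - a))\<close> converges along the whole sequence. Its limit, computed
  along either subsequence, shows that \<open>b - a\<close> has \<open>M\<close>-norm zero.\<close>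

lemma fejer_weak_limits_unique:
  assumes conv: "convergent (\<lambda>n. inner (x n - a) (M (x n - a)))"
      "convergent (\<lambda>n. inner (x n - b) (M (x n - b)))"
    and r: "strict_mono r" "weakly_converges_to (x \<circ> r) a"
    and s: "strict_mono s" "weakly_converges_to (x \<circ> s) b"
  shows "a = b"
proof -
  have "inner (x n) (M (b - a)) = (inner (x n - a) (M (x n - a)) - inner (x n - b) (M (x n - b))
      - (inner a (M a) - inner b (M b))) / 2" for n
    by (simp add: inner_diff_left inner_diff_right M.diff inner_M_swap[of a "x n"] inner_M_swap[of b "x n"])
  moreover obtain l l' where "(\<lambda>n. inner (x n - a) (M (x n - a))) \<longlonglongrightarrow> l"
      "(\<lambda>n. inner (x n - b) (M (x n - b))) \<longlonglongrightarrow> l'"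
    using conv unfolding convergent_def by blast
  then have "(\<lambda>n. (inner (x n - a) (M (x n - a)) - inner (x n - b) (M (x n - b))
      - (inner a (M a) - inner b (M b))) / 2) \<longlonglongrightarrow> (l - l' - (inner a (M a) - inner b (M b))) / 2"
    by (intro tendsto_intros) auto
  ultimately obtain L where L: "(\<lambda>n. inner (x n) (M (b - a))) \<longlonglongrightarrow> L" by simp
  have "inner a (M (b - a)) = L"
    using LIMSEQ_subseq_LIMSEQ[OF L r(1)] r(2) LIMSEQ_unique
    unfolding weakly_converges_to_def o_def by blast
  moreover have "inner b (M (b - a)) = L"
    using LIMSEQ_subseq_LIMSEQ[OF L s(1)] s(2) LIMSEQ_unique
    unfolding weakly_converges_to_def o_def by blast
  ultimately have "inner (b - a) (M (b - a)) = 0" by (simp add: inner_diff_left)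
  then have "(\<lambda>n::nat. b - a) \<longlonglongrightarrow> 0" by (intro null_sequenceI) simp
  then show ?thesis by (simp add: LIMSEQ_const_iff)
qed

end

section \<open>Convergence of the iteration\<close>

theorem theorem1:
  fixes M :: "'a::{real_inner, complete_space} \<Rightarrow> 'a"
    and A :: "'a \<Rightarrow> 'a set"
    and C :: "'a \<Rightarrow> 'a"
    and \<beta> \<epsilon> :: real
    and \<zeta> \<gamma> lam l2 :: "nat \<Rightarrow> real"
    and x u v y z p :: "nat \<Rightarrow> 'a"
  assumes "bounded_linear M" and "self_adjoint M" and "strongly_positive M"
    and "\<beta> > 0"
    and "maximally_monotone A"
    and "cocoercive_wrt (1 / \<beta>) M C"
    and "zer (op_plus C A) \<noteq> {}"
    and "\<epsilon> \<in> {0<..<min 1 (4 / (3 + \<beta>))}"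
    and "\<And>n. 0 \<le> \<zeta> n \<and> \<zeta> n \<le> 1 - \<epsilon>"
    and "\<And>n. \<epsilon> \<le> \<gamma> n \<and> \<gamma> n \<le> (4 - 3 * \<epsilon>) / \<beta>"
    and "\<And>n. \<epsilon> \<le> lam n \<and> lam n \<le> 2 - \<gamma> n * \<beta> / 2 - \<epsilon> / 2"
    and "fb_with_deviations M A C \<beta> \<zeta> \<gamma> lam x u v y z p l2"
  shows "(summable l2 \<and> u \<longlonglongrightarrow> 0 \<and> v \<longlonglongrightarrow> 0) \<and>
         (\<forall>x'\<in>zer (op_plus C A). convergent (\<lambda>n. norm_wrt M (x n - x'))) \<and>
         (\<exists>x'\<in>zer (op_plus C A). weakly_converges_to x x')"
proof -
  interpret spd_operator M using assms(1-3) by (rule spd_operator.intro)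
  have \<beta>: "\<beta> > 0" and max: "maximally_monotone A" and coco: "cocoercive_wrt (1 / \<beta>) M C"
    by fact+
  have \<epsilon>: "\<epsilon> > 0" and \<zeta>: "\<And>n. 0 \<le> \<zeta> n" "\<And>n. \<zeta> n \<le> 1 - \<epsilon>"
    and \<gamma>: "\<And>n. \<epsilon> \<le> \<gamma> n" and lam: "\<And>n. \<epsilon> \<le> lam n" "\<And>n. lam n \<le> 2 - \<gamma> n * \<beta> / 2 - \<epsilon> / 2"
    using assms(8-11) by auto
  \<comment> \<open>The denominators \<open>r n\<close> and \<open>s n\<close> will be bounded away
    from zero uniformly in \<open>n\<close>; this keeps all coefficients below bounded.\<close>
  define t r s where "t n = \<gamma> n * \<beta>" and "r n = 2 - lam n * \<gamma> n * \<beta>"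
    and "s n = 4 - 2 * lam n - \<gamma> n * \<beta>" for n
  have t: "\<epsilon> * \<beta> \<le> t n" "t n \<le> 4" for n
  proof -
    show "\<epsilon> * \<beta> \<le> t n" using \<gamma> \<beta> by (simp add: t_def)
    show "t n \<le> 4" using lam[of n] \<epsilon> by (simp add: t_def)
  qed
  have pos: "lam n > 0" "\<gamma> n > 0" "t n > 0" for n
    using \<epsilon> \<gamma>[of n] lam(1)[of n] t(1)[of n] \<beta> mult_pos_pos[OF \<epsilon> \<beta>] by linarith+
  have s: "\<epsilon> \<le> s n" "s n \<le> 4" for n
    using lam(2)[of n] pos[of n] by (auto simp: s_def t_def)
  have lam2: "lam n \<le> 2" for n using lam(2)[of n] pos(3)[of n] \<epsilon> unfolding t_def by linarith
  \<comment> \<open>Inserting the upper bound for \<open>lam n\<close> into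
    \<open>lam n * t n\<close> and completing the square at \<open>t n = 2\<close> leaves the gap
    \<open>\<epsilon> * t n / 2\<close>, and \<open>t n \<ge> \<epsilon> * \<beta>\<close>.\<close>
  define \<rho> where "\<rho> = \<epsilon>\<^sup>2 * \<beta> / 2"
  have \<rho>: "\<rho> > 0" using \<epsilon> \<beta> by (simp add: \<rho>_def)
  have r: "\<rho> \<le> r n" "r n \<le> 2" for n
  proof -
    have "lam n * t n \<le> (2 - t n / 2 - \<epsilon> / 2) * t n"
      using lam(2)[of n] pos(3)[of n] by (intro mult_right_mono) (auto simp: t_def)
    also have "\<dots> = 2 - (t n - 2)\<^sup>2 / 2 - \<epsilon> * t n / 2"
      by (simp add: power2_eq_square field_simps)
    also have "\<dots> \<le> 2 - \<epsilon> * (\<epsilon> * \<beta>) / 2"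
      using mult_left_mono[OF t(1)[of n] less_imp_le[OF \<epsilon>]] zero_le_power2[of "t n - 2"] by linarith
    finally show "\<rho> \<le> r n" by (simp add: \<rho>_def r_def t_def power2_eq_square mult.assoc)
    show "r n \<le> 2" using mult_pos_pos[OF pos(1,3), of n n] by (simp add: r_def t_def mult.assoc)
  qed
  have rs_pos: "r n > 0" "s n > 0" for n
    using r(1)[of n] \<rho> s(1)[of n] \<epsilon> by linarith+
  define g where "g n = p n - x n + (lam n * \<gamma> n * \<beta> / r n) *\<^sub>R u n - (2 * (1 - lam n) / s n) *\<^sub>R v n" for n
  \<comment> \<open>The left-hand side of the deviation bound at index \<open>n\<close>. The
    algorithm bounds it from index 1 on; at index 0 it vanishes with \<open>u 0\<close> and
    \<open>v 0\<close>.\<close>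
  define dev where "dev n = lam n * \<gamma> n * \<beta> / r n * inner (u n) (M (u n))
      + lam n * r n / s n * inner (v n) (M (v n))" for n
  have fb: "u 0 = 0" "v 0 = 0" "\<And>n. y n = x n + u n"
    "\<And>n. z n = x n + ((1 - lam n) * \<gamma> n * \<beta> / r n) *\<^sub>R u n + v n"
    "\<And>n. \<exists>a\<in>A (p n). M (z n) - \<gamma> n *\<^sub>R C (y n) = M (p n) + \<gamma> n *\<^sub>R a"
    "\<And>n. x (Suc n) = x n + lam n *\<^sub>R (p n - z n)"
    "\<And>n. l2 n = lam n * s n / 2 * inner (g n) (M (g n))"
    "\<And>n. dev (Suc n) \<le> \<zeta> n * l2 n"
    using assms(12) unfolding fb_with_deviations_def op_inverse_def op_plus_def op_scale_def
      norm_wrt_power2 r_def[symmetric] s_def[symmetric] g_def[symmetric] dev_def[symmetric]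
    by blast+
  obtain a where a: "\<And>n. a n \<in> A (p n)"
      "\<And>n. M (z n) - \<gamma> n *\<^sub>R C (y n) = M (p n) + \<gamma> n *\<^sub>R a n"
    using fb(5) by metis
  have l2_nonneg: "0 \<le> l2 n" for n
    unfolding fb(7) using pos(1)[of n] rs_pos[of n] inner_nonneg by simp
  have dev_0: "dev 0 \<le> 0" by (simp add: dev_def fb M.zero)

  define f where "f w n = inv M (C (y n) - C w) + (\<beta> / 2) *\<^sub>R (p n - y n)" for w n
  have fejer: "summable l2" "summable (\<lambda>n. 2 * lam n * \<gamma> n / \<beta> * inner (f w n) (M (f w n)))"
      "convergent (\<lambda>n. inner (x n - w) (M (x n - w)))"
    if w: "w \<in> zer (op_plus C A)" for w
  proof -
    have Cw: "- C w \<in> A w"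
      using w by (auto simp: zer_def op_plus_def eq_neg_iff_add_eq_0 add.commute)
        (metis add.commute eq_neg_iff_add_eq_0)
    have "inner (x (Suc n) - w) (M (x (Suc n) - w)) + 2 * lam n * \<gamma> n / \<beta> * inner (f w n) (M (f w n))
        \<le> inner (x n - w) (M (x n - w)) - l2 n + dev n" for n
      unfolding fb(7) dev_def
    proof (rule forward_backward_step)
      \<comment> \<open>Monotonicity of \<open>A\<close> between the pairs \<open>(p n, a n)\<close>
        and \<open>(w, - C w)\<close>, scaled by \<open>\<gamma> n\<close>.\<close>
      have "0 \<le> inner (a n - (- C w)) (p n - w)"
        using max a(1)[of n] Cw unfolding maximally_monotone_def monotone_op_def by blast
      then have "0 \<le> \<gamma> n * inner (a n - (- C w)) (p n - w)" using pos(2)[of n] by simp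
      also have "\<dots> = inner (M (z n) - M (p n) - \<gamma> n *\<^sub>R (C (y n) - C w)) (p n - w)"
      proof -
        have "M (z n) - M (p n) - \<gamma> n *\<^sub>R (C (y n) - C w) = \<gamma> n *\<^sub>R (a n - (- C w))"
          using a(2)[of n] by (simp add: algebra_simps)
        then show ?thesis by simp
      qed
      finally show "0 \<le> inner (M (z n) - M (p n) - \<gamma> n *\<^sub>R (C (y n) - C w)) (p n - w)" .
      show "1 / \<beta> * (norm_wrt (inv M) (C (y n) - C w))\<^sup>2 \<le> inner (C (y n) - C w) (y n - w)"
        using coco unfolding cocoercive_wrt_def by blast
      show "r n \<noteq> 0" "s n \<noteq> 0" using rs_pos[of n] by auto
    qed (auto simp: pos \<beta> fb(3,4,6) r_def s_def f_def g_def)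
    from lyapunov_summable_convergent[where a = "\<lambda>n. inner (x n - w) (M (x n - w))", OF \<epsilon> \<zeta> _ _ l2_nonneg this dev_0 fb(8)]
    show "summable l2" "summable (\<lambda>n. 2 * lam n * \<gamma> n / \<beta> * inner (f w n) (M (f w n)))"
      "convergent (\<lambda>n. inner (x n - w) (M (x n - w)))"
      using pos \<beta> by (simp_all add: inner_nonneg less_imp_le)
  qed

  obtain w where w: "w \<in> zer (op_plus C A)" using assms(7) by blast
  have l2_null: "l2 \<longlonglongrightarrow> 0" using fejer(1)[OF w] by (rule summable_LIMSEQ_zero)
  have dev_le: "dev (Suc n) \<le> l2 n" for n
  proof -
    have "\<zeta> n * l2 n \<le> 1 * l2 n"
      using \<zeta>(2)[of n] \<epsilon> l2_nonneg by (intro mult_right_mono) auto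
    then show ?thesis using fb(8)[of n] by simp
  qed
  \<comment> \<open>The constants combine \<open>lam n \<ge> \<epsilon>\<close>,
    \<open>t n \<ge> \<epsilon> * \<beta>\<close> and \<open>r n \<ge> \<rho>\<close> with the upper
    bounds \<open>r n \<le> 2\<close> and \<open>s n \<le> 4\<close>.\<close>
  have dev_terms: "\<rho> * inner (u n) (M (u n)) \<le> dev n"
    "\<epsilon> * \<rho> / 4 * inner (v n) (M (v n)) \<le> dev n" for n
  proof -
    have "\<epsilon> * (\<epsilon> * \<beta>) / 2 \<le> lam n * t n / r n"
      using lam(1)[of n] t(1)[of n] r(2)[of n] rs_pos[of n] pos[of n] \<epsilon> \<beta>
      by (intro frac_le mult_mono) auto
    then have 1: "\<rho> \<le> lam n * \<gamma> n * \<beta> / r n"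
      using \<rho> \<epsilon> by (simp add: \<rho>_def t_def power2_eq_square mult.assoc)
    have 2: "\<epsilon> * \<rho> / 4 \<le> lam n * r n / s n"
      using lam(1)[of n] r(1)[of n] s(2)[of n] rs_pos[of n] \<epsilon> \<rho>
      by (intro frac_le mult_mono) auto
    have "0 \<le> lam n * \<gamma> n * \<beta> / r n * inner (u n) (M (u n))"
      "0 \<le> lam n * r n / s n * inner (v n) (M (v n))"
      using pos[of n] rs_pos[of n] \<beta> inner_nonneg by simp_all
    then show "\<rho> * inner (u n) (M (u n)) \<le> dev n"
      "\<epsilon> * \<rho> / 4 * inner (v n) (M (v n)) \<le> dev n"
      using mult_right_mono[OF 1 inner_nonneg[of "u n"]] mult_right_mono[OF 2 inner_nonneg[of "v n"]]
      unfolding dev_def by linarith+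
  qed
  have "(\<lambda>n. u (Suc n)) \<longlonglongrightarrow> 0"
    by (rule null_sequenceI_scaled[OF l2_null _ order_trans[OF dev_terms(1) dev_le]])
      (use \<rho> \<epsilon> in simp)
  then have u: "u \<longlonglongrightarrow> 0" by (simp add: filterlim_sequentially_Suc)
  have "(\<lambda>n. v (Suc n)) \<longlonglongrightarrow> 0"
    by (rule null_sequenceI_scaled[OF l2_null _ order_trans[OF dev_terms(2) dev_le]])
      (use \<rho> \<epsilon> in simp)
  then have v: "v \<longlonglongrightarrow> 0" by (simp add: filterlim_sequentially_Suc)

  \<comment> \<open>Summability of \<open>l2\<close> controls \<open>g\<close> and not
    \<open>p n - x n\<close> directly; the terms in \<open>u\<close> and \<open>v\<close> are
    removed by boundedness of their coefficients, which need not converge.\<close>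
  have "g \<longlonglongrightarrow> 0"
  proof (rule null_sequenceI_scaled[OF l2_null])
    show "\<epsilon> * \<epsilon> / 2 * inner (g n) (M (g n)) \<le> l2 n" for n
      unfolding fb(7) using lam(1)[of n] s(1)[of n] pos[of n] \<epsilon>
      by (intro mult_right_mono divide_right_mono mult_mono inner_nonneg) auto
  qed (use \<epsilon> in simp)
  moreover have "(\<lambda>n. (lam n * \<gamma> n * \<beta> / r n) *\<^sub>R u n) \<longlonglongrightarrow> 0"
  proof (rule tendsto_bounded_scaleR_zero[OF u])
    fix n
    have "lam n * t n / r n \<le> 2 * 4 / \<rho>"
      using lam2[of n] t(2)[of n] r(1)[of n] pos[of n] \<rho> by (intro frac_le mult_mono) auto
    then show "\<bar>lam n * \<gamma> n * \<beta> / r n\<bar> \<le> 2 * 4 / \<rho>"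
      using pos[of n] rs_pos[of n] \<beta> by (simp add: t_def mult.assoc)
  qed
  moreover have "(\<lambda>n. (2 * (1 - lam n) / s n) *\<^sub>R v n) \<longlonglongrightarrow> 0"
  proof (rule tendsto_bounded_scaleR_zero[OF v])
    fix n
    have "\<bar>2 * (1 - lam n)\<bar> / s n \<le> 2 / \<epsilon>"
      using lam2[of n] s(1)[of n] pos[of n] \<epsilon> by (intro frac_le) auto
    then show "\<bar>2 * (1 - lam n) / s n\<bar> \<le> 2 / \<epsilon>"
      using rs_pos[of n] by simp
  qed
  ultimately have "(\<lambda>n. g n - (lam n * \<gamma> n * \<beta> / r n) *\<^sub>R u n + (2 * (1 - lam n) / s n) *\<^sub>R v n) \<longlonglongrightarrow> 0 - 0 + 0"
    by (intro tendsto_add tendsto_diff)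
  then have px: "(\<lambda>n. p n - x n) \<longlonglongrightarrow> 0" by (simp add: g_def)
  have "(\<lambda>n. ((1 - lam n) * \<gamma> n * \<beta> / r n) *\<^sub>R u n) \<longlonglongrightarrow> 0"
  proof (rule tendsto_bounded_scaleR_zero[OF u])
    fix n
    have "\<bar>1 - lam n\<bar> * t n / r n \<le> 1 * 4 / \<rho>"
      using lam2[of n] t(2)[of n] r(1)[of n] pos[of n] \<rho> by (intro frac_le mult_mono) auto
    then show "\<bar>(1 - lam n) * \<gamma> n * \<beta> / r n\<bar> \<le> 1 * 4 / \<rho>"
      using pos[of n] rs_pos[of n] \<beta> by (simp add: t_def mult.assoc abs_mult)
  qed
  then have "(\<lambda>n. ((1 - lam n) * \<gamma> n * \<beta> / r n) *\<^sub>R u n + v n - (p n - x n)) \<longlonglongrightarrow> 0 + 0 - 0"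
    by (intro tendsto_add tendsto_diff v px)
  then have zp: "(\<lambda>n. z n - p n) \<longlonglongrightarrow> 0" by (simp add: fb(4) algebra_simps)
  have "(\<lambda>n. (p n - x n) - u n) \<longlonglongrightarrow> 0 - 0" by (intro tendsto_diff px u)
  then have py: "(\<lambda>n. p n - y n) \<longlonglongrightarrow> 0" by (simp add: fb(3) algebra_simps)
  then have yp: "(\<lambda>n. y n - p n) \<longlonglongrightarrow> 0" using tendsto_minus by fastforce

  have "f w \<longlonglongrightarrow> 0"
  proof (rule null_sequenceI_scaled[OF summable_LIMSEQ_zero[OF fejer(2)[OF w]]])
    show "2 * \<epsilon> * \<epsilon> / \<beta> * inner (f w n) (M (f w n)) \<le> 2 * lam n * \<gamma> n / \<beta> * inner (f w n) (M (f w n))" for n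
      using lam(1)[of n] \<gamma>[of n] pos[of n] \<epsilon> \<beta>
      by (intro mult_right_mono divide_right_mono mult_mono inner_nonneg) auto
  qed (use \<epsilon> \<beta> in simp)
  \<comment> \<open>Removing the null part of \<open>f w n\<close> leaves
    \<open>inv M (C (y n) - C w)\<close>, and the continuous \<open>M\<close> undoes
    \<open>inv M\<close>.\<close>
  then have "(\<lambda>n. M (f w n - (\<beta> / 2) *\<^sub>R (p n - y n))) \<longlonglongrightarrow> M (0 - (\<beta> / 2) *\<^sub>R 0)"
    by (intro M.tendsto tendsto_diff tendsto_scaleR tendsto_const py)
  then have "(\<lambda>n. C (y n) - C w) \<longlonglongrightarrow> 0" by (simp add: f_def M_inv M.zero)
  then have Cy: "(\<lambda>n. C (y n)) \<longlonglongrightarrow> C w" by (rule LIM_zero_cancel)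
  \<comment> \<open>The resolvent equation is solved for \<open>a n\<close>; the lower bound on
    \<open>\<gamma> n\<close> keeps the factor \<open>1 / \<gamma> n\<close> bounded.\<close>
  have "(\<lambda>n. (1 / \<gamma> n) *\<^sub>R M (z n - p n)) \<longlonglongrightarrow> 0"
  proof (rule tendsto_bounded_scaleR_zero)
    show "(\<lambda>n. M (z n - p n)) \<longlonglongrightarrow> 0" using M.tendsto[OF zp] by (simp add: M.zero)
    show "\<bar>1 / \<gamma> n\<bar> \<le> 1 / \<epsilon>" for n
      using \<gamma>[of n] pos(2)[of n] \<epsilon> by (simp add: frac_le)
  qed
  then have "(\<lambda>n. (1 / \<gamma> n) *\<^sub>R M (z n - p n) - C (y n)) \<longlonglongrightarrow> 0 - C w"
    by (intro tendsto_diff Cy)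
  moreover have "(\<lambda>n. (1 / \<gamma> n) *\<^sub>R M (z n - p n) - C (y n)) = a"
  proof
    fix n
    have "M (z n - p n) = \<gamma> n *\<^sub>R (a n + C (y n))"
      using a(2)[of n] by (simp add: M.diff algebra_simps)
    then show "(1 / \<gamma> n) *\<^sub>R M (z n - p n) - C (y n) = a n" using pos(2)[of n] by simp
  qed
  ultimately have a_lim: "a \<longlonglongrightarrow> - C w" by simp

  obtain R where R: "\<And>n. norm (x n) \<le> R" using bounded_of_fejer[OF fejer(3)[OF w]] by metis
  obtain R' where R': "\<And>n. norm (p n - x n) \<le> R'"
    using convergent_imp_Bseq[OF convergentI[OF px]] unfolding Bseq_def by auto
  have p_bnd: "norm (p n) \<le> R + R'" for n
    using norm_triangle_ineq[of "x n" "p n - x n"] R[of n] R'[of n] by simp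
  \<comment> \<open>The limit of \<open>C (y n)\<close> is \<open>C w\<close> for the zero
    \<open>w\<close> fixed above, whichever cluster point \<open>l\<close> is considered.\<close>
  have cluster: "l \<in> zer (op_plus C A)"
    if k: "strict_mono k" "weakly_converges_to (x \<circ> k) l" for k l
  proof (rule weak_limit_in_zer[OF max \<beta> coco])
    show "weakly_converges_to (p \<circ> k) l"
      using weakly_converges_to_add_null[OF k(2) LIMSEQ_subseq_LIMSEQ[OF px k(1)]]
      by (simp add: o_def)
    show "norm ((p \<circ> k) n) \<le> R + R'" for n using p_bnd by simp
    show "(\<lambda>n. (y \<circ> k) n - (p \<circ> k) n) \<longlonglongrightarrow> 0"
      using LIMSEQ_subseq_LIMSEQ[OF yp k(1)] by (simp add: o_def)
    show "(a \<circ> k) n \<in> A ((p \<circ> k) n)" for n using a(1) by simp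
    show "(a \<circ> k) \<longlonglongrightarrow> - C w" by (rule LIMSEQ_subseq_LIMSEQ[OF a_lim k(1)])
    show "(\<lambda>n. C ((y \<circ> k) n)) \<longlonglongrightarrow> C w"
      using LIMSEQ_subseq_LIMSEQ[OF Cy k(1)] by (simp add: o_def)
  qed
  obtain l k where k: "strict_mono k" "weakly_converges_to (x \<circ> k) l"
    by (rule bounded_imp_weakly_convergent_subsequence[OF R])
  have "weakly_converges_to x l"
  proof (rule weakly_converges_toI_subsequences[OF R])
    fix k' l' assume k': "strict_mono k'" "weakly_converges_to (x \<circ> k') l'"
    show "l' = l"
      by (rule fejer_weak_limits_unique[OF fejer(3)[OF cluster[OF k']] fejer(3)[OF cluster[OF k]] k' k])
  qed
  moreover have "convergent (\<lambda>n. norm_wrt M (x n - x'))" if "x' \<in> zer (op_plus C A)" for x'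
    using fejer(3)[OF that] unfolding norm_wrt_def convergent_def by (auto intro: tendsto_real_sqrt)
  ultimately show ?thesis using fejer(1)[OF w] u v cluster[OF k] by blast
qed

end
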